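(* For every prime $p$ there exists a tile counting function $f\in\mathcal{F}$ such that $\mathrm{ord}_p(f(n))=\mathrm{ord}_p(C_n)$ for all $n\in\mathbb{N}$, where $C_n=\frac{1}{n+1}\binom{2n}{n}$ is the $n$-th Catalan number and $\mathrm{ord}_p(m)=\max\{d: p^d\mid m\}$.
   Context: $\mathbb{N}=\{0,1,2,\ldots\}$. Tile counting functions: A tile is an axis-parallel simply connected closed polygon in $\mathbb{R}^2$ (side lengths may be irrational); tiles are considered up to translation. A tile is tall if it has height exactly $1$. For real $a\ge 0$ let $R_a=[1\times a]$ be the rectangle of height $1$ and length $a$. A tiling of $R_a$ with a finite set of tiles $T$ is a collection of translates of tiles of $T$ (no rotations or reflections) with pairwise disjoint interiors whose union is $R_a$ (for $a=0$ the only tiling is the empty one). For a finite set $T$ of tall tiles and a fixed real $\varepsilon\ge 0$, let $f_{T,\varepsilon}(n)$ be the number of tilings of $R_{n+\varepsilon}$ with $T$, $n\in\mathbb{N}$. $\mathcal{F}$ denotes the set of all functions $f_{T,\varepsilon}:\mathbb{N}\to\mathbb{N}$ obtained in this way. *)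

theory Defs
  imports "HOL-Analysis.Analysis" "HOL-Computational_Algebra.Primes" "HOL-Library.Extended_Nat"
begin

definition axis_parallel_segment :: "(real \<times> real) set \<Rightarrow> bool" where
  "axis_parallel_segment s \<longleftrightarrow>
     (\<exists>a b. s = closed_segment a b \<and> (fst a = fst b \<or> snd a = snd b))"

text \<open>
  A polygon is understood as a region: a compact set that is the closure of its nonempty,
  connected interior and is bounded by finitely many segments. Connectedness of the interior
  excludes regions pinched at a vertex, so that together with simple connectedness the tiles are
  exactly the regions enclosed by a simple closed axis-parallel polygonal curve. For a compact set
  that is the closure of its interior, it makes no difference whether the frontier is required
  to be equal to, or just contained in, a finite union of axis-parallel segments.
\<close>

definition axis_parallel_polygon :: "(real \<times> real) set \<Rightarrow> bool" where
  "axis_parallel_polygon P \<longleftrightarrow>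
     compact P \<and> interior P \<noteq> {} \<and> connected (interior P) \<and> closure (interior P) = P \<and>
     (\<exists>E. finite E \<and> (\<forall>s\<in>E. axis_parallel_segment s) \<and> frontier P \<subseteq> \<Union>E)"

definition tile :: "(real \<times> real) set \<Rightarrow> bool" where
  "tile P \<longleftrightarrow> axis_parallel_polygon P \<and> simply_connected P"

definition height :: "(real \<times> real) set \<Rightarrow> real" where
  "height P = Sup (snd ` P) - Inf (snd ` P)"

definition tall_tile :: "(real \<times> real) set \<Rightarrow> bool" where
  "tall_tile P \<longleftrightarrow> tile P \<and> height P = 1"

definition rect :: "real \<Rightarrow> (real \<times> real) set" where
  "rect a = {0..a} \<times> {0..1}"

text \<open>
  A tiling is the set of the placed tiles, so listing two translates of the same tile in \<open>T\<close> does
  not change the tilings: this is how tiles are taken up to translation. The degenerate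
  rectangle of length 0 is a nonempty segment, hence the separate case.
\<close>

definition is_tiling ::
    "(real \<times> real) set set \<Rightarrow> real \<Rightarrow> (real \<times> real) set set \<Rightarrow> bool" where
  "is_tiling T a S \<longleftrightarrow>
     (if a = 0 then S = {}
      else (\<forall>Q\<in>S. \<exists>P\<in>T. \<exists>v. Q = (+) v ` P) \<and>
           pairwise (\<lambda>Q Q'. interior Q \<inter> interior Q' = {}) S \<and>
           \<Union>S = rect a)"

text \<open>
  For a finite set \<open>T\<close> of tall tiles there are only finitely many tilings of a given rectangle,
  so \<^const>\<open>card\<close> is the actual number of tilings.
\<close>

definition tile_count :: "(real \<times> real) set set \<Rightarrow> real \<Rightarrow> nat \<Rightarrow> nat" where
  "tile_count T \<epsilon> n = card {S. is_tiling T (real n + \<epsilon>) S}"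

definition tile_counting_functions :: "(nat \<Rightarrow> nat) set" where
  "tile_counting_functions =
     {tile_count T \<epsilon> | T \<epsilon>. finite T \<and> (\<forall>P\<in>T. tall_tile P) \<and> \<epsilon> \<ge> 0}"

definition catalan :: "nat \<Rightarrow> nat" where
  "catalan n = ((2 * n) choose n) div (n + 1)"

lemma of_nat_catalan: "real (catalan n) = 1 / (real n + 1) * real ((2 * n) choose n)"
proof -
  have "Suc n * ((2 * n) choose Suc n) = n * ((2 * n) choose n)"
    using binomial_absorb_comp[of "2 * n" n] Suc_times_binomial_eq[of "2 * n - 1" n]
    by (cases n) (simp_all add: binomial_absorption)
  then have "((2 * n) choose n) = Suc n * (((2 * n) choose n) - ((2 * n) choose Suc n))"
    by (simp add: diff_mult_distrib2)
  then have "(n + 1) dvd ((2 * n) choose n)"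
    by (metis Suc_eq_plus1 dvd_triv_left)
  then show ?thesis
    by (simp add: catalan_def real_of_nat_div add.commute)
qed

text \<open>\<^const>\<open>multiplicity\<close> is 0 at 0, where the order is infinite.\<close>

definition ord_at :: "nat \<Rightarrow> nat \<Rightarrow> enat" where
  "ord_at p m = (if m = 0 then \<infinity> else enat (multiplicity p m))"

lemma ord_at_eq_Sup:
  assumes "prime p"
  shows "ord_at p m = (SUP d\<in>{d. p ^ d dvd m}. enat d)"
proof (cases "m = 0")
  case True
  have "(SUP d. enat d) = \<infinity>"
    by (rule ccontr) (metis SUP_upper UNIV_I enat_ord_simps(1) lessI not_less not_infinity_eq)
  with True show ?thesis by (simp add: ord_at_def)
next
  case False
  moreover have "\<not> is_unit p" using assms by auto
  ultimately have "{d. p ^ d dvd m} = {..multiplicity p m}"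
    by (auto simp: power_dvd_iff_le_multiplicity)
  moreover have "(SUP d\<in>{..k}. enat d) = enat k" for k
    by (intro antisym SUP_least SUP_upper) auto
  ultimately show ?thesis using False by (simp add: ord_at_def)
qed

end

theory Submission
  imports Defs "HOL-Combinatorics.Multiset_Permutations"
begin

text \<open>
  Rectangles suffice as tiles. A tiling of a rectangle by rectangles of height 1 is a word over the
  set of their lengths, so one has to count the words with sum \<open>n + \<epsilon>\<close>. Lengths are integer
  combinations of \<open>x = \<surd>2 - 1\<close>, \<open>y = 2 - \<surd>2\<close> and \<open>\<surd>3\<close>, which are linearly independent over the
  rationals, and \<open>x + y = 1\<close>. Besides \<open>x\<close> and \<open>y\<close> there are marker letters, with positive
  \<open>\<surd>3\<close>-coordinate; \<open>\<epsilon>\<close> is a multiple of \<open>\<surd>3\<close> chosen such that a word of length \<open>n + \<epsilon>\<close> contains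
  either one special marker or one of finitely many pairs of complementary markers. The markers
  shift the numbers of letters \<open>x\<close> and \<open>y\<close> away from \<open>n\<close>, and the number of pairs with a given shift
  can be prescribed. Each admissible collection of markers contributes a multinomial coefficient that
  is a polynomial multiple of the Catalan number \<open>C\<^sub>n\<close>: \<open>(2n + 1)(n + 1)\<close> and \<open>(2n + 1)n\<close> for two
  special markers, \<open>n\<^sup>2(n + 1)\<close> and \<open>(2n + 1)(n + 1)n\<close> for the two kinds of pairs. With 8 pairs of
  the first and \<open>4(p - 1)\<close> of the second kind the sum is \<open>C\<^sub>n (1 + 4p(2n + 1)(n + 1)n)\<close>.
\<close>

section \<open>Tilings by rectangles\<close>

definition strip :: "real \<Rightarrow> real \<Rightarrow> (real \<times> real) set" where
  "strip a b = {a..b} \<times> {0..1}"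

lemma rect_translate: "(+) (a, b) ` rect l = {a..a + l} \<times> {b..b + 1}"
proof -
  have "(+) (a, b) = (\<lambda>(x, y). (a + x, b + y))"
    by (auto simp: fun_eq_iff)
  then have "(+) (a, b) ` rect l = (+) a ` {0..l} \<times> (+) b ` {0..1}"
    by (simp add: rect_def image_paired_Times)
  then show ?thesis by (simp add: add.commute)
qed

lemma interior_strip: "interior (strip a b) = {a<..<b} \<times> {0<..<1}"
  by (simp add: strip_def interior_Times)

lemma tall_tile_rect:
  assumes "l > 0"
  shows "tall_tile (rect l)"
proof -
  have int: "interior (rect l) = {0<..<l} \<times> {0<..<1}"
    by (simp add: rect_def interior_Times)
  have conv: "convex (rect l)"
    unfolding rect_def by (intro convex_Times convex_real_interval)
  have comp: "compact (rect l)"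
    unfolding rect_def by (intro compact_Times compact_Icc)
  have clos: "closure (interior (rect l)) = rect l"
    using assms by (simp add: int closure_Times) (simp add: rect_def)
  let ?E = "{closed_segment (0,0) (l,0), closed_segment (0,1) (l,1),
             closed_segment (0,0) (0,1), closed_segment (l,0) (l,1::real)}"
  have seg: "(t, c) \<in> closed_segment (0, c) (l, c)" if "0 \<le> t" "t \<le> l" for t c :: real
    unfolding in_segment using that assms
    by (intro exI[of _ "t / l"]) (auto simp: field_simps)
  have seg': "(c, t) \<in> closed_segment (c, 0) (c, 1)" if "0 \<le> t" "t \<le> 1" for t c :: real
    unfolding in_segment using that
    by (intro exI[of _ t]) (auto simp: algebra_simps)
  have "frontier (rect l) \<subseteq> \<Union>?E"
  proof
    fix z assume "z \<in> frontier (rect l)"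
    then have "z \<in> rect l" "z \<notin> interior (rect l)"
      using comp by (auto simp: frontier_def compact_imp_closed)
    then obtain s t where z: "z = (s, t)" "0 \<le> s" "s \<le> l" "0 \<le> t" "t \<le> 1"
      "s = 0 \<or> s = l \<or> t = 0 \<or> t = 1"
      unfolding int by (force simp: rect_def)
    then show "z \<in> \<Union>?E"
      using seg[of s 0] seg[of s 1] seg'[of t 0] seg'[of t l] by auto
  qed
  moreover have "\<forall>s\<in>?E. axis_parallel_segment s"
    unfolding axis_parallel_segment_def by (auto simp: prod_eq_iff)
  moreover have "finite ?E"
    by simp
  moreover have "interior (rect l) \<noteq> {}"
    using int assms by simp
  moreover have "connected (interior (rect l))"
    using conv by (simp add: convex_connected)
  ultimately have "axis_parallel_polygon (rect l)"
    unfolding axis_parallel_polygon_def using comp clos by blast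
  moreover have "snd ` rect l = {0..1}"
    using assms by (auto simp: rect_def image_iff)
  ultimately show ?thesis
    by (simp add: tall_tile_def tile_def height_def convex_imp_simply_connected conv)
qed

section \<open>Tilings laid out from words of lengths\<close>

fun place :: "real \<Rightarrow> real list \<Rightarrow> (real \<times> real) set set" where
  "place t [] = {}"
| "place t (l # w) = insert (strip t (t + l)) (place (t + l) w)"

text \<open>The left end \<open>t\<close> varies because tilings are taken apart from the left. For
  \<open>t = c\<close> the union has to be empty and not the degenerate segment
  \<open>strip c c\<close>, so that the empty tiling ends the recursion.\<close>

definition strip_tiling :: "real set \<Rightarrow> real \<Rightarrow> real \<Rightarrow> (real \<times> real) set set \<Rightarrow> bool" where
  "strip_tiling L t c S \<longleftrightarrow>
     (\<forall>Q\<in>S. \<exists>a. \<exists>l\<in>L. Q = strip a (a + l)) \<and>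
     pairwise (\<lambda>Q Q'. interior Q \<inter> interior Q' = {}) S \<and>
     \<Union>S = (if t = c then {} else strip t c)"

text \<open>A tile of height 1 has no vertical freedom in a rectangle of height 1: its lower and its
  upper edge both lie in the rectangle, so the second coordinate of the translation is 0.\<close>

lemma is_tiling_iff_strip_tiling:
  assumes "c > 0" "\<And>l. l \<in> L \<Longrightarrow> l > 0"
  shows "is_tiling (rect ` L) c S \<longleftrightarrow> strip_tiling L 0 c S"
proof -
  have "(\<exists>P\<in>rect ` L. \<exists>v. Q = (+) v ` P) \<longleftrightarrow> (\<exists>a. \<exists>l\<in>L. Q = strip a (a + l))"
    if S: "\<Union>S = strip 0 c" and Q: "Q \<in> S" for Q
  proof
    assume "\<exists>P\<in>rect ` L. \<exists>v. Q = (+) v ` P"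
    then obtain l a b where l: "l \<in> L" and Qe: "Q = {a..a + l} \<times> {b..b + 1}"
      using rect_translate by auto
    have "(a, b) \<in> strip 0 c" "(a, b + 1) \<in> strip 0 c"
      using Union_upper[OF Q, unfolded S Qe] assms(2)[OF l] by auto
    then have "b = 0" by (simp add: strip_def)
    with l Qe show "\<exists>a. \<exists>l\<in>L. Q = strip a (a + l)" by (auto simp: strip_def)
  next
    assume "\<exists>a. \<exists>l\<in>L. Q = strip a (a + l)"
    then obtain a l where "l \<in> L" "Q = (+) (a, 0) ` rect l"
      unfolding rect_translate strip_def by auto
    then show "\<exists>P\<in>rect ` L. \<exists>v. Q = (+) v ` P" by blast
  qed
  moreover have "rect c = strip 0 c"
    by (simp add: rect_def strip_def)
  ultimately show ?thesis
    using assms(1) unfolding is_tiling_def strip_tiling_def by auto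
qed

lemma strips_disjoint_iff:
  assumes "a < b" "c < d"
  shows "interior (strip a b) \<inter> interior (strip c d) = {} \<longleftrightarrow> b \<le> c \<or> d \<le> a"
proof -
  have "interior (strip a b) \<inter> interior (strip c d) = {max a c<..<min b d} \<times> {0<..<1}"
    by (auto simp: interior_strip)
  then show ?thesis
    using assms by (auto simp: max_def min_def not_less split: if_splits)
qed

lemma strip_subset_iff:
  assumes "a \<le> b"
  shows "strip a b \<subseteq> strip c d \<longleftrightarrow> c \<le> a \<and> b \<le> d"
  using assms by (auto simp: strip_def times_subset_iff)

lemma strip_eq_iff:
  assumes "a \<le> b" "c \<le> d"
  shows "strip a b = strip c d \<longleftrightarrow> a = c \<and> b = d"
  using assms by (auto simp: set_eq_subset strip_subset_iff)

lemma in_placeD: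
  assumes "Q \<in> place t w" "\<And>l. l \<in> set w \<Longrightarrow> l > 0"
  shows "\<exists>a l. Q = strip a (a + l) \<and> l \<in> set w \<and> t \<le> a"
  using assms
proof (induction w arbitrary: t)
  case (Cons k w)
  show ?case
  proof (cases "Q = strip t (t + k)")
    case False
    then have "Q \<in> place (t + k) w" using Cons.prems by simp
    then obtain a l where "Q = strip a (a + l)" "l \<in> set w" "t + k \<le> a"
      using Cons.IH Cons.prems(2) by (metis list.set_intros(2))
    then show ?thesis using Cons.prems(2)[of k] by force
  qed auto
qed simp

lemma strip_tiling_place:
  assumes "set w \<subseteq> L" "\<And>l. l \<in> L \<Longrightarrow> l > 0"
  shows "strip_tiling L t (t + sum_list w) (place t w)"
  using assms(1)
proof (induction w arbitrary: t)
  case Nil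
  then show ?case by (simp add: strip_tiling_def)
next
  case (Cons l w)
  let ?c = "t + l + sum_list w"
  have l: "l \<in> L" "l > 0" and w: "set w \<subseteq> L"
    using Cons.prems assms(2) by auto
  have nonneg: "sum_list w \<ge> 0"
    using w assms(2) by (intro sum_list_nonneg) force
  have IH: "strip_tiling L (t + l) ?c (place (t + l) w)"
    using Cons.IH w by blast
  have disj: "interior (strip t (t + l)) \<inter> interior Q = {}" if Q: "Q \<in> place (t + l) w" for Q
  proof -
    have pos: "\<And>k. k \<in> set w \<Longrightarrow> k > 0"
      using w assms(2) by blast
    obtain a k where "Q = strip a (a + k)" "k \<in> set w" "t + l \<le> a"
      using in_placeD[OF Q pos] by blast
    moreover have "k > 0" using calculation(2) pos by blast
    ultimately have "Q = strip a (a + k)" "k > 0" "t + l \<le> a" by blast+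
    then show ?thesis using l by (simp add: strips_disjoint_iff)
  qed
  have "strip t (t + l) \<union> (if sum_list w = 0 then {} else strip (t + l) ?c) = strip t ?c"
    using l nonneg by (auto simp: strip_def)
  moreover have "sum_list w + l \<noteq> 0"
    using l nonneg by linarith
  ultimately have "\<Union>(place t (l # w)) = (if t = ?c then {} else strip t ?c)"
    using IH by (auto simp: strip_tiling_def algebra_simps)
  then show ?case
    using IH l disj
    by (auto simp: strip_tiling_def pairwise_insert Int_commute add.assoc)
qed

text \<open>All tiles after the first start at \<open>t + l\<close> or further right, so the tile
  that starts at \<open>t\<close> reveals the first letter. Removing it leaves the layout of the
  remaining word.\<close>

lemma place_inj:
  assumes "place t w = place t w'" "\<And>l. l \<in> set w \<Longrightarrow> l > 0" "\<And>l. l \<in> set w' \<Longrightarrow> l > 0"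
  shows "w = w'"
  using assms
proof (induction w arbitrary: t w')
  case Nil
  then show ?case by (cases w') auto
next
  case (Cons l w)
  then obtain l' v where w': "w' = l' # v"
    by (cases w') auto
  have pos: "l > 0" "l' > 0" "\<And>k. k \<in> set w \<Longrightarrow> k > 0" "\<And>k. k \<in> set v \<Longrightarrow> k > 0"
    using Cons.prems w' by auto
  have later: "strip t (t + k) \<notin> place (t + l) u"
    if "l > 0" "k > 0" "\<And>k. k \<in> set u \<Longrightarrow> k > 0" for k l u
  proof
    assume "strip t (t + k) \<in> place (t + l) u"
    from in_placeD[OF this that(3)] obtain a m
      where "strip t (t + k) = strip a (a + m)" "m \<in> set u" "t + l \<le> a" by blast
    then show False using that(1,2) that(3)[of m] strip_eq_iff[of t "t + k" a "a + m"] by simp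
  qed
  have "strip t (t + l) \<in> place t w'"
    using Cons.prems(1) by auto
  then have "strip t (t + l) = strip t (t + l')"
    using later[of l' l v] pos unfolding w' by auto
  then have "l = l'"
    using pos by (simp add: strip_eq_iff)
  moreover have "place (t + l) w = place (t + l) v"
    using Cons.prems(1) later[OF pos(1) pos(1), of w] later[OF pos(1) pos(1), of v] pos(3,4)
    unfolding w' \<open>l = l'\<close>[symmetric] by (simp add: insert_ident)
  ultimately show ?case
    using Cons.IH[of "t + l" v] pos w' by auto
qed

section \<open>Reading a tiling from left to right as a word\<close>

lemma strip_tilingD:
  assumes "strip_tiling L t c S" "t < c" "\<And>l. l \<in> L \<Longrightarrow> l \<ge> m" "m > 0"
  obtains l where "l \<in> L" "t + l \<le> c" "strip t (t + l) \<in> S"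
    "strip_tiling L (t + l) c (S - {strip t (t + l)})"
proof -
  have tiles: "\<exists>a l. l \<in> L \<and> l \<ge> m \<and> Q = strip a (a + l) \<and> t \<le> a \<and> a + l \<le> c" if Q: "Q \<in> S" for Q
  proof -
    obtain a l where al: "l \<in> L" "Q = strip a (a + l)"
      using assms(1) Q unfolding strip_tiling_def by blast
    have "Q \<subseteq> strip t c"
      using assms(1,2) Q by (auto simp: strip_tiling_def)
    with al assms(3)[OF al(1)] assms(4) show ?thesis
      by (auto simp: strip_subset_iff)
  qed
  have cover: "\<exists>a l. l \<in> L \<and> l \<ge> m \<and> strip a (a + l) \<in> S \<and> t \<le> a \<and> a + l \<le> c \<and> a \<le> s \<and> s \<le> a + l
      \<and> y \<in> {0..1}" if "(s, y) \<in> strip t c" for s y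
  proof -
    have "(s, y) \<in> \<Union>S"
      using assms(1,2) that by (auto simp: strip_tiling_def)
    then obtain Q where "Q \<in> S" "(s, y) \<in> Q" by blast
    with tiles[of Q] show ?thesis by (fastforce simp: strip_def)
  qed
  have disj: "a + l \<le> b \<or> b + k \<le> a \<or> (a = b \<and> l = k)"
    if "strip a (a + l) \<in> S" "strip b (b + k) \<in> S" "l \<ge> m" "k \<ge> m" for a b l k
  proof (cases "strip a (a + l) = strip b (b + k)")
    case True
    then show ?thesis using that assms(4) by (simp add: strip_eq_iff)
  next
    case False
    then have "interior (strip a (a + l)) \<inter> interior (strip b (b + k)) = {}"
      using assms(1) that by (auto simp: strip_tiling_def pairwise_def)
    then show ?thesis using that assms(4) by (auto simp: strips_disjoint_iff)
  qed
  \<comment> \<open>The tile through the corner \<open>(t, 0)\<close> cannot start left of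
    \<open>t\<close>, so it starts exactly there.\<close>
  obtain l where l: "l \<in> L" "l \<ge> m" "strip t (t + l) \<in> S" "t + l \<le> c"
    using cover[of t 0] assms(2) by (force simp: strip_def)
  let ?Q = "strip t (t + l)"
  have right: "t + l \<le> a" if "strip a (a + k) \<in> S - {?Q}" "k \<ge> m" "t \<le> a" for a k
    using disj[of t l a k] that l assms(4) by auto
  have start: "\<exists>k\<in>L. strip (t + l) (t + l + k) \<in> S - {?Q}" if "t + l < c"
  proof -
    \<comment> \<open>The point \<open>s\<close> lies to the right of \<open>t + l\<close> by less
      than \<open>m\<close>, the minimal length of a tile. The tile over \<open>s\<close> must start
      at \<open>t + l\<close>: a gap before it would have to be filled by a tile too long to
      fit.\<close>
    define s where "s = min c (t + l + m / 2)"
    have s: "t + l < s" "s \<le> c" "s < t + l + m"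
      using that assms(4) by (auto simp: s_def)
    then have "(s, 0) \<in> strip t c"
      using l assms(4) by (auto simp: strip_def)
    from cover[OF this] obtain a k
      where k: "k \<in> L" "k \<ge> m" "strip a (a + k) \<in> S" "t \<le> a" "a \<le> s" "s \<le> a + k" by blast
    have ne: "strip a (a + k) \<noteq> ?Q"
      using k(2,6) l(2) s(1) assms(4) by (auto simp: strip_eq_iff)
    then have a: "t + l \<le> a" using right k by auto
    have "a = t + l"
    proof (rule ccontr)
      assume "a \<noteq> t + l"
      define r where "r = (t + l + a) / 2"
      have r: "t + l < r" "r < a" using a \<open>a \<noteq> t + l\<close> by (auto simp: r_def)
      then have "(r, 0) \<in> strip t c"
        using l assms(4) k s by (auto simp: strip_def)
      from cover[OF this] obtain b h
        where h: "h \<ge> m" "strip b (b + h) \<in> S" "t \<le> b" "b \<le> r" "r \<le> b + h" by blast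
      have "strip b (b + h) \<noteq> ?Q"
        using h l(2) r assms(4) by (auto simp: strip_eq_iff)
      then have "t + l \<le> b" using right h by auto
      with disj[OF h(2) k(3) h(1) k(2)] h k r s show False by auto
    qed
    with k ne show ?thesis by blast
  qed
  have "\<Union>(S - {?Q}) = (if t + l = c then {} else strip (t + l) c)"
  proof (intro set_eqI iffI)
    fix z assume "z \<in> \<Union>(S - {?Q})"
    then obtain Q where Q: "Q \<in> S - {?Q}" "z \<in> Q" by blast
    then obtain a k where ak: "k \<ge> m" "Q = strip a (a + k)" "t \<le> a" "a + k \<le> c"
      using tiles[of Q] by blast
    then have "t + l \<le> a" using right Q by blast
    then show "z \<in> (if t + l = c then {} else strip (t + l) c)"
      using Q ak assms(4) by (auto simp: strip_def)
  next
    fix z assume "z \<in> (if t + l = c then {} else strip (t + l) c)"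
    then have lc: "t + l < c" and z: "z \<in> strip (t + l) c"
      using l by (auto split: if_splits)
    show "z \<in> \<Union>(S - {?Q})"
    proof (cases "fst z = t + l")
      \<comment> \<open>Points on the common edge also belong to the removed tile, so covering by
        \<open>S\<close> alone does not yield another tile there; \<open>start\<close> supplies
        one.\<close>
      case True
      obtain k where "k \<in> L" "strip (t + l) (t + l + k) \<in> S - {?Q}"
        using start lc by blast
      moreover have "z \<in> strip (t + l) (t + l + k)"
        using True z assms(3)[OF \<open>k \<in> L\<close>] assms(4) by (auto simp: strip_def)
      ultimately show ?thesis by blast
    next
      case False
      then have "z \<notin> ?Q" using z by (auto simp: strip_def)
      moreover have "z \<in> strip t c" using z l assms(4) by (auto simp: strip_def)
      then have "z \<in> \<Union>S" using assms(1,2) by (auto simp: strip_tiling_def)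
      ultimately show ?thesis by blast
    qed
  qed
  then have "strip_tiling L (t + l) c (S - {?Q})"
    using assms(1) by (auto simp: strip_tiling_def intro: pairwise_subset)
  with that l show ?thesis by blast
qed

text \<open>Tiles are removed from the left one at a time. Each uses up at least \<open>m\<close> of
  the remaining length, so a bound \<open>N\<close> on that length in units of \<open>m\<close>
  serves for induction.\<close>

lemma strip_tiling_imp_place:
  assumes "strip_tiling L t c S" "t \<le> c" "\<And>l. l \<in> L \<Longrightarrow> l \<ge> m" "m > 0"
  shows "\<exists>w. set w \<subseteq> L \<and> t + sum_list w = c \<and> S = place t w"
proof -
  obtain N :: nat where "(c - t) / m < real N"
    using reals_Archimedean2 by blast
  then have "c - t < real N * m"
    using assms(4) by (simp add: field_simps)
  then show ?thesis
    using assms(1,2)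
  proof (induction N arbitrary: t S)
    case (Suc N)
    show ?case
    proof (cases "t = c")
      case True
      have "Q \<noteq> {}" if "Q \<in> S" for Q
        using Suc.prems(2) that assms(3,4)
        by (force simp: strip_tiling_def strip_def)
      moreover have "\<Union>S = {}"
        using Suc.prems(2) True by (simp add: strip_tiling_def)
      ultimately have "S = {}" by blast
      with True show ?thesis by (intro exI[of _ "[]"]) simp
    next
      case False
      then obtain l where l: "l \<in> L" "t + l \<le> c" "strip t (t + l) \<in> S"
        "strip_tiling L (t + l) c (S - {strip t (t + l)})"
        using strip_tilingD[OF Suc.prems(2) _ assms(3,4)] Suc.prems(3) by force
      have "c - (t + l) < real N * m"
        using Suc.prems(1) assms(3)[OF l(1)] by (simp add: algebra_simps)
      with Suc.IH l obtain w
        where "set w \<subseteq> L" "t + l + sum_list w = c" "S - {strip t (t + l)} = place (t + l) w"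
        by blast
      with l show ?thesis by (intro exI[of _ "l # w"]) auto
    qed
  qed simp
qed

lemma card_tilings_rect:
  assumes "finite L" "\<And>l. l \<in> L \<Longrightarrow> l > 0" "c > 0"
  shows "card {S. is_tiling (rect ` L) c S} = card {w. set w \<subseteq> L \<and> sum_list w = c}"
proof -
  \<comment> \<open>Inserting 1 keeps the minimum meaningful and positive when \<open>L\<close> is
    empty.\<close>
  define m where "m = Min (insert 1 L)"
  have m: "m > 0" "\<And>l. l \<in> L \<Longrightarrow> l \<ge> m"
    using assms(1,2) by (auto simp: m_def)
  have "{S. is_tiling (rect ` L) c S} = place 0 ` {w. set w \<subseteq> L \<and> sum_list w = c}"
    using strip_tiling_imp_place[of L 0 c _ m] strip_tiling_place[of _ L 0] m assms
    by (fastforce simp: is_tiling_iff_strip_tiling)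
  moreover have "inj_on (place 0) {w. set w \<subseteq> L \<and> sum_list w = c}"
    using assms(2) by (intro inj_onI) (blast intro: place_inj)
  ultimately show ?thesis by (simp add: card_image)
qed

section \<open>Words with a given sum\<close>

text \<open>By commutativity the sum of a word depends only on its multiset of letters, so the words
  can be grouped by that multiset.\<close>

lemma sum_list_eq_card_permutations:
  fixes L :: "'a :: comm_monoid_add set"
  assumes "finite {m. set_mset m \<subseteq> L \<and> \<Sum>\<^sub># m = c}"
  shows "card {w. set w \<subseteq> L \<and> sum_list w = c} =
    (\<Sum>m\<in>{m. set_mset m \<subseteq> L \<and> \<Sum>\<^sub># m = c}. card (permutations_of_multiset m))"
proof -
  have "{w. set w \<subseteq> L \<and> sum_list w = c} =
      (\<Union>m\<in>{m. set_mset m \<subseteq> L \<and> \<Sum>\<^sub># m = c}. permutations_of_multiset m)"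
    by (auto simp: permutations_of_multiset_def sum_mset_sum_list)
  then show ?thesis
    using assms by (auto dest!: permutations_of_multisetD intro!: card_UN_disjoint)
qed

text \<open>The multinomial coefficient, written without division. Letters of \<open>B\<close> that
  do not occur in \<open>A\<close> contribute the factor \<open>fact 0 = 1\<close>.\<close>

lemma card_permutations_of_multiset_prod:
  assumes "finite B" "set_mset A \<subseteq> B"
  shows "card (permutations_of_multiset A) * (\<Prod>x\<in>B. fact (count A x)) = fact (size A)"
proof -
  have "(\<Prod>x\<in>B. fact (count A x)) = (\<Prod>x\<in>set_mset A. fact (count A x) :: nat)"
    using assms by (intro prod.mono_neutral_right) (auto simp: not_in_iff)
  then show ?thesis using card_permutations_of_multiset_aux[of A] by simp
qed

section \<open>Linear independence of 1, sqrt 2 and sqrt 3\<close>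

lemma square_ratio_irrational:
  fixes v w :: int
  assumes "prime q" "\<not> q dvd k" "q * v\<^sup>2 = k * w\<^sup>2"
  shows "v = 0"
proof (rule ccontr)
  assume v: "v \<noteq> 0"
  have q: "prime_elem q" "q \<noteq> 0" using assms(1) by auto
  have k: "k \<noteq> 0" "w \<noteq> 0" using assms v q by auto
  \<comment> \<open>The exponent of \<open>q\<close> would be odd on one side of the equation and
    even on the other.\<close>
  have "multiplicity q (q * v\<^sup>2) = 1 + 2 * multiplicity q v"
    using q v by (simp add: prime_elem_multiplicity_mult_distrib prime_elem_multiplicity_power_distrib)
  moreover have "multiplicity q (k * w\<^sup>2) = 2 * multiplicity q w"
    using q k assms(2)
    by (simp add: prime_elem_multiplicity_mult_distrib prime_elem_multiplicity_power_distrib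
        not_dvd_imp_multiplicity_0)
  ultimately have "1 + 2 * multiplicity q v = 2 * multiplicity q w"
    using assms(3) by simp
  then show False by arith
qed

lemma sqrt2_sqrt3_independent:
  fixes a b c :: int
  assumes "of_int a + of_int b * sqrt 2 + of_int c * sqrt 3 = 0"
  shows "a = 0 \<and> b = 0 \<and> c = 0"
proof -
  have p: "prime (2::int)" "prime (3::int)" by simp_all
  have irr2: "y = 0" if "real_of_int x + real_of_int y * sqrt 2 = 0" for x y
  proof -
    have "(real_of_int x)\<^sup>2 = (- (real_of_int y * sqrt 2))\<^sup>2"
      using that by (intro arg_cong[where f = "\<lambda>x. x\<^sup>2"]) linarith
    then have "real_of_int (2 * y\<^sup>2) = real_of_int (1 * x\<^sup>2)"
      by (simp add: power_mult_distrib)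
    then have "2 * y\<^sup>2 = 1 * x\<^sup>2"
      by (simp only: of_int_eq_iff)
    then show "y = 0"
      using square_ratio_irrational[OF p(1), of 1 y x] by simp
  qed
  \<comment> \<open>Isolating \<open>sqrt 3\<close> and squaring leaves a relation between 1 and
    \<open>sqrt 2\<close> only; its irrational part forces \<open>a * b = 0\<close>.\<close>
  have "(real_of_int a + of_int b * sqrt 2)\<^sup>2 = (- (of_int c * sqrt 3))\<^sup>2"
    using assms by (intro arg_cong[where f = "\<lambda>x. x\<^sup>2"]) linarith
  then have "real_of_int (a\<^sup>2 + 2 * b\<^sup>2 - 3 * c\<^sup>2) + real_of_int (2 * a * b) * sqrt 2 = 0"
    by (simp add: power_mult_distrib power2_sum algebra_simps)
  note eq = this
  have ab: "2 * a * b = 0" by (rule irr2[OF eq])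
  then have "real_of_int (a\<^sup>2 + 2 * b\<^sup>2 - 3 * c\<^sup>2) = 0"
    using eq by (simp only: of_int_0 mult_zero_left add_0_right)
  then have "a\<^sup>2 + 2 * b\<^sup>2 = 3 * c\<^sup>2"
    by (simp only: of_int_eq_0_iff)
  with ab consider "a = 0" "2 * b\<^sup>2 = 3 * c\<^sup>2" | "b = 0" "3 * c\<^sup>2 = 1 * a\<^sup>2"
    by auto
  then show ?thesis
  proof cases
    case 1
    then have "b = 0" using square_ratio_irrational[OF p(1), of 3 b c] by simp
    with 1 show ?thesis by simp
  next
    case 2
    then have "c = 0" using square_ratio_irrational[OF p(2), of 1 c a] by simp
    with 2 show ?thesis by simp
  qed
qed

section \<open>An alphabet with markers\<close>

text \<open>Coordinates with respect to \<open>x\<close>, \<open>y\<close>, \<open>\<surd>3\<close>.\<close>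

type_synonym weight = "int \<times> int \<times> int"

abbreviation wt :: "weight \<Rightarrow> int" where "wt z \<equiv> snd (snd z)"

definition upper :: "nat \<Rightarrow> nat \<Rightarrow> weight" where
  "upper J j = (0, 0, 4 * int J + int j)"

text \<open>Together with \<open>upper J j\<close> this gives \<open>(1, 1, 8 J)\<close> for
  \<open>j \<le> K\<close> and \<open>(1, 0, 8 J)\<close> for larger \<open>j\<close>. These are the
  two kinds of pairs: \<open>K\<close> of the indices up to \<open>J\<close> belong to the first
  when \<open>K \<le> J\<close>.\<close>

definition lower :: "nat \<Rightarrow> nat \<Rightarrow> nat \<Rightarrow> weight" where
  "lower K J j = (1, if j \<le> K then 1 else 0, 4 * int J - int j)"

text \<open>
  All markers have third coordinate at least \<open>3 J\<close>, so at most two of them add up to \<open>8 J\<close> there,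
  and two do so only if they are \<open>upper J j\<close> and \<open>lower K J j\<close> for the same \<open>j\<close>.
\<close>

definition markers :: "nat \<Rightarrow> nat \<Rightarrow> weight set" where
  "markers K J = {(0, 0, 8 * int J), (-1, 1, 8 * int J)} \<union> upper J ` {1..J} \<union> lower K J ` {1..J}"

definition alphabet :: "nat \<Rightarrow> nat \<Rightarrow> weight set" where
  "alphabet K J = {(1, 0, 0), (0, 1, 0)} \<union> markers K J"

definition word_type :: "nat \<Rightarrow> nat \<Rightarrow> weight multiset \<Rightarrow> weight multiset" where
  "word_type a b R = replicate_mset a (1, 0, 0) + replicate_mset b (0, 1, 0) + R"

section \<open>Collections of markers with third coordinate 8 J\<close>

lemma wt_markers:
  assumes "z \<in> markers K J"
  shows "wt z \<ge> 3 * int J"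
  using assms by (auto simp: markers_def upper_def lower_def)

lemma markers_cases:
  assumes "z \<in> markers K J"
  obtains "z = (0, 0, 8 * int J)" | "z = (-1, 1, 8 * int J)"
  | j where "j \<in> {1..J}" "z = upper J j" | j where "j \<in> {1..J}" "z = lower K J j"
  using assms unfolding markers_def by blast

lemma marker_multiset_cases:
  assumes "set_mset R \<subseteq> markers K J" "wt (\<Sum>\<^sub># R) = 8 * int J" "J \<ge> 1"
  obtains "R = {#(0, 0, 8 * int J)#}" | "R = {#(-1, 1, 8 * int J)#}"
  | j where "j \<in> {1..J}" "R = {#upper J j, lower K J j#}"
proof -
  have nonneg: "wt (\<Sum>\<^sub># Q) \<ge> 0" if "set_mset Q \<subseteq> markers K J" for Q
    using that
  proof (induction Q)
    case (add z Q)
    then show ?case using wt_markers[of z K J] by simp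
  qed simp
  consider "R = {#}" | r where "R = {#r#}" | r s where "R = {#r, s#}"
    | r s t Q where "R = add_mset r (add_mset s (add_mset t Q))"
    by (metis multiset_cases)
  then show ?thesis
  proof cases
    case 1
    then show ?thesis using assms by simp
  next
    case (2 r)
    then have "r \<in> markers K J" "wt r = 8 * int J" using assms by auto
    then show ?thesis
      using that(1,2) 2 assms(3) by (cases rule: markers_cases) (auto simp: upper_def lower_def)
  next
    case (3 r s)
    then have r: "r \<in> markers K J" and s: "s \<in> markers K J" and sum: "wt r + wt s = 8 * int J"
      using assms by auto
    have "wt s \<ge> 3 * int J" "wt r \<ge> 3 * int J"
      using r s wt_markers by blast+
    \<comment> \<open>This excludes the special markers: one of them would leave weight 0 for its
      partner.\<close>
    then have "wt r < 8 * int J" "wt s < 8 * int J"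
      using sum assms(3) by linarith+
    then obtain i j where ij: "i \<in> {1..J}" "j \<in> {1..J}"
      "r = upper J i \<or> r = lower K J i" "s = upper J j \<or> s = lower K J j"
      using r s unfolding markers_def by auto
    \<comment> \<open>The offsets from \<open>4 J\<close> must cancel. As both indices are positive,
      the signs are opposite and the indices agree.\<close>
    from ij(3,4) have "i = j \<and> (r = upper J j \<and> s = lower K J j \<or> s = upper J j \<and> r = lower K J j)"
      using sum ij(1,2) by (elim disjE) (simp_all add: upper_def lower_def)
    with that(3) 3 ij(2) show ?thesis by (metis add_mset_commute)
  next
    case (4 r s t Q)
    then have "wt r \<ge> 3 * int J" "wt s \<ge> 3 * int J" "wt t \<ge> 3 * int J" "wt (\<Sum>\<^sub># Q) \<ge> 0"
      using assms(1) 4 by (auto intro!: wt_markers[of _ K J] nonneg)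
    moreover have "wt r + wt s + wt t + wt (\<Sum>\<^sub># Q) = 8 * int J"
      using assms(2) 4 by simp
    ultimately show ?thesis using assms(3) by linarith
  qed
qed

section \<open>Letter multisets with the prescribed sum\<close>

lemma sum_replicate_mset:
  "\<Sum>\<^sub># (replicate_mset n (a, b, c)) = (int n * a, int n * b, int n * (c :: int))"
  by (induction n) (auto simp: algebra_simps zero_prod_def)

lemma sum_word_type:
  "\<Sum>\<^sub># (word_type a b R) = (int a, int b, 0) + \<Sum>\<^sub># R"
  by (simp add: word_type_def sum_replicate_mset)

lemma word_type_exhaust:
  assumes "set_mset m \<subseteq> alphabet K J"
  obtains a b R where "m = word_type a b R" "set_mset R \<subseteq> markers K J"
proof -
  have "\<exists>a b R. m = word_type a b R \<and> set_mset R \<subseteq> markers K J"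
    using assms
  proof (induction m)
    case empty
    then show ?case by (intro exI[of _ 0] exI[of _ "{#}"]) (simp add: word_type_def)
  next
    case (add z m)
    then obtain a b R where IH: "m = word_type a b R" "set_mset R \<subseteq> markers K J"
      by auto
    consider "z = (1, 0, 0)" | "z = (0, 1, 0)" | "z \<in> markers K J"
      using add.prems by (auto simp: alphabet_def)
    then show ?case
    proof cases
      case 1
      then show ?thesis using IH
        by (intro exI[of _ "Suc a"] exI[of _ b] exI[of _ R]) (simp add: word_type_def)
    next
      case 2
      then show ?thesis using IH
        by (intro exI[of _ a] exI[of _ "Suc b"] exI[of _ R]) (simp add: word_type_def)
    next
      case 3
      then show ?thesis using IH
        by (intro exI[of _ a] exI[of _ b] exI[of _ "add_mset z R"]) (simp add: word_type_def)
    qed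
  qed
  then show thesis using that by blast
qed

lemma set_word_type:
  assumes "set_mset R \<subseteq> markers K J"
  shows "set_mset (word_type a b R) \<subseteq> alphabet K J"
  using assms by (auto simp: word_type_def alphabet_def split: if_splits)

definition pair_type :: "nat \<Rightarrow> nat \<Rightarrow> nat \<Rightarrow> nat \<Rightarrow> weight multiset" where
  "pair_type K J n j =
     word_type (n - 1) (if j \<le> K then n - 1 else n) {#upper J j, lower K J j#}"

text \<open>Once the markers are known, the first two coordinates determine how often x and y occur.
  For \<open>n = 0\<close> every choice except the first special marker would require a negative
  number of letters.\<close>

lemma word_types_of_sum:
  assumes "J \<ge> 1"
  shows "{m. set_mset m \<subseteq> alphabet K J \<and> \<Sum>\<^sub># m = (int n, int n, 8 * int J)} =
    insert (word_type n n {#(0, 0, 8 * int J)#})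
      (if n = 0 then {} else
        insert (word_type (n + 1) (n - 1) {#(-1, 1, 8 * int J)#}) (pair_type K J n ` {1..J}))"
    (is "?A = ?B")
proof (intro set_eqI iffI)
  fix m assume "m \<in> ?A"
  then have m: "set_mset m \<subseteq> alphabet K J" "\<Sum>\<^sub># m = (int n, int n, 8 * int J)" by auto
  obtain a b R where R: "m = word_type a b R" "set_mset R \<subseteq> markers K J"
    using word_type_exhaust[OF m(1)] .
  have sum: "(int a, int b, 0) + \<Sum>\<^sub># R = (int n, int n, 8 * int J)"
    using m(2) R(1) by (simp add: sum_word_type)
  then have "wt (\<Sum>\<^sub># R) = 8 * int J"
    by (metis add_0 snd_add snd_conv)
  from R(2) this assms show "m \<in> ?B"
  proof (cases rule: marker_multiset_cases)
    case 1
    then show ?thesis using sum R(1) by auto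
  next
    case 2
    then have "a = n + 1" "b = n - 1" "n \<noteq> 0" using sum by auto
    then show ?thesis using 2 R(1) by auto
  next
    case (3 j)
    then have "a = n - 1" "b = (if j \<le> K then n - 1 else n)" "n \<noteq> 0"
      using sum by (auto simp: upper_def lower_def split: if_splits)
    then show ?thesis using 3 R(1) by (auto simp: pair_type_def)
  qed
next
  fix m assume "m \<in> ?B"
  then consider "m = word_type n n {#(0, 0, 8 * int J)#}"
    | "n \<noteq> 0" "m = word_type (n + 1) (n - 1) {#(-1, 1, 8 * int J)#}"
    | j where "n \<noteq> 0" "j \<in> {1..J}" "m = pair_type K J n j"
    by (auto split: if_splits)
  then show "m \<in> ?A"
  proof cases
    case 1
    have "set_mset m \<subseteq> alphabet K J"
      unfolding 1 by (rule set_word_type) (simp add: markers_def)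
    then show ?thesis by (simp add: 1 sum_word_type)
  next
    case 2
    have "set_mset m \<subseteq> alphabet K J"
      unfolding 2 by (rule set_word_type) (simp add: markers_def)
    then show ?thesis using 2(1) by (simp add: 2(2) sum_word_type of_nat_diff)
  next
    case (3 j)
    have "set_mset m \<subseteq> alphabet K J"
      unfolding 3 pair_type_def using 3(2) by (intro set_word_type) (auto simp: markers_def)
    then show ?thesis
      using 3(1,2) by (simp add: 3(3) pair_type_def sum_word_type upper_def lower_def of_nat_diff)
  qed
qed

section \<open>Number of words with given letters\<close>

lemma count_word_type:
  assumes "x \<notin> {(1, 0, 0), (0, 1, 0)}"
  shows "count (word_type a b R) x = count R x"
  using assms by (auto simp: word_type_def)

text \<open>No marker is repeated, so only x and y contribute nontrivial factorials to the
  denominator of the multinomial coefficient.\<close>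

lemma card_permutations_word_type:
  assumes "\<And>x. x \<in># R \<Longrightarrow> count R x = 1" "(1, 0, 0) \<notin># R" "(0, 1, 0) \<notin># R"
  shows "card (permutations_of_multiset (word_type a b R)) * (fact a * fact b) =
    fact (a + b + size R)"
proof -
  let ?B = "insert (1, 0, 0) (insert (0, 1, 0) (set_mset R)) :: weight set"
  have "(\<Prod>x\<in>?B. fact (count (word_type a b R) x) :: nat) =
      fact a * (fact b * (\<Prod>x\<in>set_mset R. fact (count (word_type a b R) x)))"
    using assms by (simp add: word_type_def not_in_iff)
  also have "(\<Prod>x\<in>set_mset R. fact (count (word_type a b R) x) :: nat) = 1"
  proof (intro prod.neutral ballI)
    fix x assume x: "x \<in># R"
    then have "x \<notin> {(1, 0, 0), (0, 1, 0)}" using assms(2,3) by auto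
    then show "fact (count (word_type a b R) x) = (1 :: nat)"
      using assms(1)[OF x] by (simp add: count_word_type)
  qed
  finally have "(\<Prod>x\<in>?B. fact (count (word_type a b R) x) :: nat) = fact a * fact b"
    by simp
  moreover have "set_mset (word_type a b R) \<subseteq> ?B"
    by (auto simp: word_type_def split: if_splits)
  moreover have "size (word_type a b R) = a + b + size R"
    by (simp add: word_type_def)
  ultimately show ?thesis
    using card_permutations_of_multiset_prod[of ?B "word_type a b R"] by simp
qed

lemma card_permutations_pair_type:
  assumes "j \<in> {1..J}"
  shows "card (permutations_of_multiset (pair_type K J n j)) *
      (fact (n - 1) * fact (if j \<le> K then n - 1 else n)) =
    fact (n - 1 + (if j \<le> K then n - 1 else n) + 2)"
proof -
  have "upper J j \<noteq> lower K J j"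
    by (simp add: upper_def lower_def)
  then show ?thesis
    unfolding pair_type_def using assms
    by (subst card_permutations_word_type)
       (auto simp: upper_def lower_def split: if_splits)
qed

lemma pair_type_inj: "inj_on (pair_type K J n) {1..J}"
proof (rule inj_onI)
  fix i j assume ij: "i \<in> {1..J}" "j \<in> {1..J}" and eq: "pair_type K J n i = pair_type K J n j"
  have "upper J i \<in># pair_type K J n j"
    unfolding eq[symmetric] by (simp add: pair_type_def word_type_def)
  with ij show "i = j"
    by (auto simp: pair_type_def word_type_def upper_def lower_def split: if_splits)
qed

text \<open>The special markers tell the types apart; this is what allows their contributions to be
  added.\<close>

lemma word_types_distinct:
  assumes "J \<ge> 1"
  shows "word_type a b {#(0, 0, 8 * int J)#} \<noteq> word_type c d {#(-1, 1, 8 * int J)#}"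
    and "word_type a b {#(0, 0, 8 * int J)#} \<notin> pair_type K J n ` {1..J}"
    and "word_type a b {#(-1, 1, 8 * int J)#} \<notin> pair_type K J n ` {1..J}"
proof -
  have "(0, 0, 8 * int J) \<in># word_type a b {#(0, 0, 8 * int J)#}"
    "(-1, 1, 8 * int J) \<in># word_type a b {#(-1, 1, 8 * int J)#}"
    by (simp_all add: word_type_def)
  moreover have "(0, 0, 8 * int J) \<notin># word_type c d {#(-1, 1, 8 * int J)#}"
    using assms by (auto simp: word_type_def split: if_splits)
  moreover have "(0, 0, 8 * int J) \<notin># pair_type K J n j" "(-1, 1, 8 * int J) \<notin># pair_type K J n j"
    if "j \<in> {1..J}" for j
    using that by (auto simp: pair_type_def word_type_def upper_def lower_def split: if_splits)
  ultimately show "word_type a b {#(0, 0, 8 * int J)#} \<noteq> word_type c d {#(-1, 1, 8 * int J)#}"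
    "word_type a b {#(0, 0, 8 * int J)#} \<notin> pair_type K J n ` {1..J}"
    "word_type a b {#(-1, 1, 8 * int J)#} \<notin> pair_type K J n ` {1..J}"
    by (metis, (auto; metis)+)
qed

section \<open>Word counts as multiples of Catalan numbers\<close>

lemma catalan_fact: "catalan n * (fact (n + 1) * fact n) = fact (2 * n)"
proof -
  have "real (catalan n) * (real n + 1) = real ((2 * n) choose n)"
    by (simp add: of_nat_catalan)
  then have "((2 * n) choose n) = catalan n * (n + 1)"
    by (metis (mono_tags) of_nat_1 of_nat_add of_nat_eq_iff of_nat_mult)
  moreover have "fact n * fact n * ((2 * n) choose n) = (fact (2 * n) :: nat)"
    using binomial_fact_lemma[of n "2 * n"] by (simp add: mult_2)
  ultimately have "fact (2 * n) = fact n * fact n * (catalan n * (n + 1))"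
    by simp
  then show ?thesis
    by (simp add: algebra_simps)
qed

text \<open>Multiplication by \<open>fact (n + 1) * fact n\<close> turns the Catalan number into
  \<open>fact (2 * n)\<close> and each multinomial coefficient into a polynomial multiple of it. The
  two special markers together give \<open>(n + 1) * (2 * n + 1) + n * (2 * n + 1)\<close>, which is
  the square.\<close>

lemma card_words_alphabet:
  assumes "J \<ge> 1" "K \<le> J"
  shows "card {w. set w \<subseteq> alphabet K J \<and> sum_list w = (int n, int n, 8 * int J)} =
    catalan n * ((2 * n + 1)\<^sup>2 + K * (n\<^sup>2 * (n + 1)) + (J - K) * ((2 * n + 1) * (n + 1) * n))"
    (is "card ?W = _")
proof -
  let ?c = "\<lambda>m :: weight multiset. card (permutations_of_multiset m)"
  let ?s = "{#(0, 0, 8 * int J)#} :: weight multiset" and ?s' = "{#(-1, 1, 8 * int J)#} :: weight multiset"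
  let ?d = "fact (n + 1) * fact n :: nat"
  have W: "card ?W = (\<Sum>m\<in>{m. set_mset m \<subseteq> alphabet K J \<and> \<Sum>\<^sub># m = (int n, int n, 8 * int J)}. ?c m)"
    by (intro sum_list_eq_card_permutations) (simp add: word_types_of_sum[OF assms(1)])
  have c0: "?c (word_type n n ?s) * (fact n * fact n) = fact (2 * n + 1)"
    using assms(1) by (subst card_permutations_word_type) (auto simp: mult_2)
  have "card ?W * ?d = fact (2 * n) *
    ((2 * n + 1)\<^sup>2 + K * (n\<^sup>2 * (n + 1)) + (J - K) * ((2 * n + 1) * (n + 1) * n))"
  \<comment> \<open>For \<open>n = 0\<close> only one word type exists and the polynomial equals 1.
    In the other case \<open>m\<close> stands for \<open>n - 1\<close>.\<close>
  proof (cases n)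
    case 0
    then show ?thesis
      using c0 unfolding W word_types_of_sum[OF assms(1)] by (simp add: catalan_def)
  next
    case (Suc m)
    define F :: nat where "F = fact (2 * n)"
    have F: "fact (2 * n + 1) = (2 * n + 1) * F" by (simp add: F_def)
    have fn: "fact n = n * fact m" "fact (n + 1) = (n + 1) * (n * fact m)"
      using Suc by simp_all
    have c1: "?c (word_type (n + 1) m ?s') * (fact (n + 1) * fact m) = fact (2 * n + 1)"
      using assms(1) Suc by (subst card_permutations_word_type) (auto simp: mult_2)
    have c2: "?c (pair_type K J n j) * ?d =
        (if j \<le> K then n\<^sup>2 * (n + 1) * F else (2 * n + 1) * (n + 1) * n * F)" if "j \<in> {1..J}" for j
    proof (cases "j \<le> K")
      case True
      then have "?c (pair_type K J n j) * (fact m * fact m) = F"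
        using card_permutations_pair_type[OF that, of K n] Suc by (simp add: F_def mult_2)
      then show ?thesis
        using True by (simp add: fn power2_eq_square algebra_simps)
    next
      case False
      then have "?c (pair_type K J n j) * (fact m * fact n) = (2 * n + 1) * F"
        using card_permutations_pair_type[OF that, of K n] Suc unfolding F[symmetric]
        by (simp add: mult_2)
      then show ?thesis
        using False by (simp add: fn algebra_simps)
    qed
    have "(\<Sum>j\<in>{1..J}. ?c (pair_type K J n j)) * ?d =
        (\<Sum>j\<in>{1..J}. if j \<le> K then n\<^sup>2 * (n + 1) * F else (2 * n + 1) * (n + 1) * n * F)"
      unfolding sum_distrib_right using c2 by (intro sum.cong) auto
    also have "\<dots> = K * (n\<^sup>2 * (n + 1) * F) + (J - K) * ((2 * n + 1) * (n + 1) * n * F)"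
    proof -
      have "{1..J} \<inter> {j. j \<le> K} = {1..K}" "{1..J} \<inter> - {j. j \<le> K} = {K + 1..J}"
        using assms(2) by auto
      then show ?thesis by (simp add: sum.If_cases)
    qed
    finally have c2': "(\<Sum>j\<in>{1..J}. ?c (pair_type K J n j)) * ?d = \<dots>" .
    have "card ?W = ?c (word_type n n ?s) + (?c (word_type (n + 1) m ?s') +
        (\<Sum>j\<in>{1..J}. ?c (pair_type K J n j)))"
      using Suc word_types_distinct[OF assms(1)] pair_type_inj[of K J n]
      unfolding W word_types_of_sum[OF assms(1)] by (simp add: sum.reindex)
    moreover have "?c (word_type n n ?s) * ?d = (n + 1) * ((2 * n + 1) * F)"
      using c0 unfolding F by (simp add: algebra_simps)
    moreover have "?c (word_type (n + 1) m ?s') * ?d = n * ((2 * n + 1) * F)"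
    proof -
      have "?c (word_type (n + 1) m ?s') * ?d = n * (?c (word_type (n + 1) m ?s') * (fact (n + 1) * fact m))"
        by (simp only: fn(1) mult_ac)
      then show ?thesis by (simp only: c1 F)
    qed
    ultimately have "card ?W * ?d = (n + 1) * ((2 * n + 1) * F) + (n * ((2 * n + 1) * F) +
        (K * (n\<^sup>2 * (n + 1) * F) + (J - K) * ((2 * n + 1) * (n + 1) * n * F)))"
      using c2' by (simp only: add_mult_distrib)
    then show ?thesis
      unfolding F_def[symmetric] by (simp add: algebra_simps power2_eq_square)
  qed
  also have "\<dots> = catalan n * ((2 * n + 1)\<^sup>2 + K * (n\<^sup>2 * (n + 1)) +
      (J - K) * ((2 * n + 1) * (n + 1) * n)) * ?d"
    unfolding catalan_fact[of n, symmetric] by (simp only: mult_ac)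
  finally show ?thesis
    by simp
qed

section \<open>Realisation by lengths\<close>

definition len :: "weight \<Rightarrow> real" where
  "len z = of_int (fst z) * (sqrt 2 - 1) + of_int (fst (snd z)) * (2 - sqrt 2) + of_int (wt z) * sqrt 3"

lemma len_add: "len (y + z) = len y + len z"
  by (simp add: len_def algebra_simps)

lemma len_sum_list: "len (sum_list w) = sum_list (map len w)"
  by (induction w) (simp_all add: len_add, simp add: len_def)

text \<open>For a difference \<open>(a, b, c)\<close> of weights, the coefficients of 1,
  \<open>sqrt 2\<close> and \<open>sqrt 3\<close> are \<open>2 b - a\<close>, \<open>a - b\<close>
  and \<open>c\<close>. They vanish together only if \<open>a = b = c = 0\<close>.\<close>

lemma len_inj: "inj len"
proof (rule injI)
  fix y z assume "len y = len z"
  moreover obtain a b c where y: "y = (a, b, c)" by (cases y)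
  moreover obtain a' b' c' where z: "z = (a', b', c')" by (cases z)
  ultimately have "of_int (2 * (b - b') - (a - a')) + of_int ((a - a') - (b - b')) * sqrt 2
      + of_int (c - c') * sqrt 3 = 0"
    by (simp add: len_def algebra_simps)
  from sqrt2_sqrt3_independent[OF this] show "y = z"
    by (simp add: y z)
qed

lemma len_alphabet_pos:
  assumes "z \<in> alphabet K J" "J \<ge> 1"
  shows "len z > 0"
proof -
  \<comment> \<open>The only letter with a negative coordinate is \<open>(-1, 1, 8 J)\<close>, of
    length \<open>3 - 2 sqrt 2 + 8 J sqrt 3\<close>. With this bound \<open>3 - 2 sqrt 2\<close> is
    positive.\<close>
  have "sqrt 2 < 3 / 2"
    by (rule real_less_lsqrt) (simp_all add: power_divide)
  then have s: "1 < sqrt 2" "sqrt 2 < 3 / 2" "sqrt 3 \<ge> 1"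
    by simp_all
  have pos: "real k * sqrt 3 \<ge> 1" if "k \<ge> 1" for k
    using mult_mono[of 1 "real k" 1 "sqrt 3"] that s(3) by simp
  have len_pos: "len (a, b, int k) > 0" if "k \<ge> 1" "a \<ge> 0" "b \<ge> 0" for a b k
  proof -
    have "of_int a * (sqrt 2 - 1) \<ge> 0" "of_int b * (2 - sqrt 2) \<ge> 0"
      using that(2,3) s(1,2) by simp_all
    then show ?thesis using pos[OF that(1)] by (simp add: len_def)
  qed
  consider "z = (1, 0, 0)" | "z = (0, 1, 0)" | "z \<in> markers K J"
    using assms(1) by (auto simp: alphabet_def)
  then show ?thesis
  proof cases
    case 1
    then show ?thesis using s(1) by (simp add: len_def)
  next
    case 2
    then show ?thesis using s(2) by (simp add: len_def)
  next
    case 3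
    then show ?thesis
    proof (cases rule: markers_cases)
      case 1
      then show ?thesis using len_pos[of "8 * J" 0 0] assms(2) by simp
    next
      case 2
      then show ?thesis using s(2) pos[of "8 * J"] assms(2) by (simp add: len_def)
    next
      case (3 j)
      then show ?thesis using len_pos[of "4 * J + j" 0 0] by (simp add: upper_def)
    next
      case (4 j)
      then have "4 * J - j \<ge> 1" "int (4 * J - j) = 4 * int J - int j"
        using assms(2) by auto
      then show ?thesis
        using len_pos[of "4 * J - j" 1 "if j \<le> K then 1 else 0"] 4(2)
        by (simp add: lower_def)
    qed
  qed
qed

lemma finite_alphabet: "finite (alphabet K J)"
  by (simp add: alphabet_def markers_def)

text \<open>As \<open>len\<close> is additive and injective, words of lengths with the given real
  sum correspond to words of weights with the given integer coordinates.\<close>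

lemma tile_count_alphabet:
  assumes "J \<ge> 1"
  shows "tile_count (rect ` len ` alphabet K J) (8 * real J * sqrt 3) n =
    card {w. set w \<subseteq> alphabet K J \<and> sum_list w = (int n, int n, 8 * int J)}" (is "_ = card ?W")
proof -
  \<comment> \<open>This uses x + y = 1: \<open>n\<close> copies of each add up to
    \<open>n\<close>.\<close>
  have c: "real n + 8 * real J * sqrt 3 = len (int n, int n, 8 * int J)"
    by (simp add: len_def algebra_simps)
  have "{w. set w \<subseteq> len ` alphabet K J \<and> sum_list w = len (int n, int n, 8 * int J)} = map len ` ?W"
  proof (intro set_eqI iffI)
    fix v assume v: "v \<in> {w. set w \<subseteq> len ` alphabet K J \<and> sum_list w = len (int n, int n, 8 * int J)}"
    then have "v \<in> lists (len ` alphabet K J)" by auto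
    then obtain w where w: "v = map len w" "set w \<subseteq> alphabet K J"
      unfolding lists_image by auto
    with v have "sum_list w = (int n, int n, 8 * int J)"
      by (simp add: len_sum_list[symmetric] inj_eq[OF len_inj])
    with w show "v \<in> map len ` ?W" by blast
  next
    fix v assume "v \<in> map len ` ?W"
    then show "v \<in> {w. set w \<subseteq> len ` alphabet K J \<and> sum_list w = len (int n, int n, 8 * int J)}"
      by (force simp: len_sum_list[symmetric])
  qed
  moreover have "card (map len ` ?W) = card ?W"
    using len_inj by (intro card_image) (simp add: inj_on_subset[OF inj_mapI])
  moreover have "0 < len (int n, int n, 8 * int J)"
    using assms unfolding c[symmetric] by (intro add_nonneg_pos) auto
  ultimately show ?thesis
    unfolding tile_count_def c using len_alphabet_pos assms finite_alphabet
    by (subst card_tilings_rect) auto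
qed

section \<open>Matching the order at a given prime\<close>

theorem proposition4p9:
  fixes p :: nat
  assumes "prime p"
  shows "\<exists>f\<in>tile_counting_functions. \<forall>n. ord_at p (f n) = ord_at p (catalan n)"
proof -
  \<comment> \<open>With \<open>K = 8\<close> there are \<open>J - 8 = 4 (p - 1)\<close> pairs of
    the second kind.\<close>
  define J where "J = 4 * p + 4"
  define T where "T = rect ` len ` alphabet 8 J"
  have p: "p \<ge> 2" using assms by (rule prime_ge_2_nat)
  have J: "J \<ge> 1" "8 \<le> J" using p by (simp_all add: J_def)
  have "\<forall>P\<in>T. tall_tile P"
    using len_alphabet_pos[OF _ J(1)] by (auto simp: T_def intro: tall_tile_rect)
  moreover have "finite T"
    by (simp add: T_def finite_alphabet)
  ultimately have "tile_count T (8 * real J * sqrt 3) \<in> tile_counting_functions"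
    unfolding tile_counting_functions_def by fastforce
  moreover have "ord_at p (tile_count T (8 * real J * sqrt 3) n) = ord_at p (catalan n)" for n
  proof -
    define u where "u = 1 + p * (4 * ((2 * n + 1) * (n + 1) * n))"
    obtain k where k: "p = k + 2" using p by (metis add.commute le_Suc_ex)
    \<comment> \<open>Since \<open>(2 n + 1)^2 = 1 + 4 n (n + 1)\<close>, the 8 pairs of the first
      kind raise the special contribution to \<open>1 + 4 (2 n + 1) (n + 1) n\<close>. The pairs of
      the second kind then multiply the part after 1 by \<open>p\<close>, so that \<open>u\<close>
      is 1 modulo \<open>p\<close>.\<close>
    have "(2 * n + 1)\<^sup>2 + 8 * (n\<^sup>2 * (n + 1)) + (J - 8) * ((2 * n + 1) * (n + 1) * n) = u"
      unfolding u_def J_def k by (simp add: power2_eq_square algebra_simps)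
    then have count: "tile_count T (8 * real J * sqrt 3) n = catalan n * u"
      by (simp only: T_def tile_count_alphabet[OF J(1)] card_words_alphabet[OF J])
    have "catalan n \<noteq> 0"
      using catalan_fact[of n] by (metis fact_nonzero mult_eq_0_iff)
    moreover have "\<not> p dvd u"
      using assms unfolding u_def by (metis dvd_add_left_iff dvd_triv_left not_prime_unit)
    moreover have "u \<noteq> 0"
      by (simp add: u_def)
    moreover have "multiplicity p (catalan n * u) = multiplicity p (catalan n) + multiplicity p u"
      using calculation assms by (intro prime_elem_multiplicity_mult_distrib) auto
    ultimately show ?thesis
      by (simp add: count ord_at_def not_dvd_imp_multiplicity_0)
  qed
  ultimately show ?thesis by blast
qed

end
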